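(* Let $D$ be a strongly connected digraph with $n$ vertices, and let $\ell_s(D)$ denote the maximum number of leaves in an out-branching of $D$. (a) If $D$ is an oriented graph with minimum in-degree at least $2$, then $\ell_s(D)\ge (n/4)^{1/3}-1$. (b) If $D$ is a digraph with minimum in-degree at least $3$, then $\ell_s(D)\ge (n/4)^{1/3}-1$.
   Context: Digraphs are finite, without loops and without parallel arcs (directed 2-cycles are allowed). An oriented graph is a digraph with no directed 2-cycle. The in-degree of a vertex $v$ is the number of vertices $u$ such that $uv$ is an arc. A subdigraph $T$ of $D$ is an out-tree if $T$ is an oriented tree (its underlying undirected graph is a tree) with exactly one vertex of in-degree zero in $T$, called the root. An out-branching of $D$ is an out-tree $T$ in $D$ with $V(T)=V(D)$. The leaves of $T$ are the vertices of out-degree zero in $T$. $\ell_s(D)$ is the maximum number of leaves in an out-branching of $D$ (and $\ell_s(D)=0$ if $D$ has no out-branching). *)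

theory Defs
  imports Complex_Main "Graph_Theory.Graph_Theory"
begin

locale oriented_graph = digraph +
  assumes no_2_cycles: "u \<rightarrow> v \<Longrightarrow> \<not> v \<rightarrow> u"

text \<open>
  The library represents the underlying undirected graph of \<open>T\<close> by the symmetric digraph
  \<open>mk_symmetric T\<close>. There every edge yields a closed walk \<open>a, b, a\<close> that counts as a directed
  cycle, whereas the cycles of the undirected graph correspond to the directed cycles of length
  at least 3. The library predicates \<open>forest\<close> and \<open>tree\<close> are unsuitable here: they forbid only
  directed cycles of \<open>T\<close> itself and so accept, for instance, a transitive triangle.
\<close>

definition underlying_tree :: "('a, 'b) pre_digraph \<Rightarrow> bool" where
  "underlying_tree T \<longleftrightarrow> Digraph_Component.connected T \<and>
    \<not> (\<exists>p. pre_digraph.cycle (with_proj (mk_symmetric T)) p \<and> 3 \<le> length p)"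

definition oriented_tree :: "('a, 'b) pre_digraph \<Rightarrow> bool" where
  "oriented_tree T \<longleftrightarrow> oriented_graph T \<and> underlying_tree T"

definition out_tree :: "('a, 'b) pre_digraph \<Rightarrow> bool" where
  "out_tree T \<longleftrightarrow> oriented_tree T \<and> (\<exists>!r. r \<in> verts T \<and> in_degree T r = 0)"

definition out_branching :: "('a, 'b) pre_digraph \<Rightarrow> ('a, 'b) pre_digraph \<Rightarrow> bool" where
  "out_branching T D \<longleftrightarrow> spanning T D \<and> out_tree T"

definition leaves :: "('a, 'b) pre_digraph \<Rightarrow> 'a set" where
  "leaves T = {v \<in> verts T. out_degree T v = 0}"

definition max_leaves :: "('a, 'b) pre_digraph \<Rightarrow> nat" where
  "max_leaves D =
    (if \<exists>T. out_branching T D then Max {card (leaves T) | T. out_branching T D} else 0)"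

text \<open>Meaningful only if \<open>D\<close> has at least one and only finitely many vertices.\<close>

definition min_in_degree :: "('a, 'b) pre_digraph \<Rightarrow> nat" where
  "min_in_degree D = Min (in_degree D ` verts D)"

end

theory Submission
  imports Defs
begin

text \<open>
  Take an out-branching with the maximum number \<open>l\<close> of leaves. Call a vertex bad if it is the root,
  has a sibling, or has an in-neighbour that is a leaf. Stars in \<open>D\<close> extend to out-branchings, so
  out-degrees are at most \<open>l\<close> and there are at most \<open>(l + 1)\<^sup>2\<close> bad vertices. The remaining, good
  vertices fall into vertical runs \<open>u\<^sub>0, u\<^sub>1, \<dots>\<close> (each vertex the parent of the previous one), one
  below each bad vertex, so it suffices to bound the length of a run by \<open>4l + 3\<close>.

  Every good \<open>u\<^sub>t\<close> with \<open>t > 0\<close> has an in-neighbour other than \<open>u\<^sub>t\<^sub>-\<^sub>1\<close> and \<open>u\<^sub>t\<^sub>+\<^sub>1\<close>. Hanging \<open>u\<^sub>t\<close> on it would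
  gain a leaf, unless this creates a cycle; so it is a proper descendant of \<open>u\<^sub>t\<close>. Cut the run into
  blocks of one or two consecutive vertices and hang the top of each block on its lower
  in-neighbour. The bottom of a block becomes a leaf unless some other block hangs on it. A greedy
  choice of the blocks from the top down makes a third of the run leaves, and there are
  at most \<open>l\<close> of them.
\<close>

section \<open>Trees given by a parent function\<close>

text \<open>The tree is encoded by its parent function; the rank function \<open>h\<close> excludes cycles.\<close>

definition out_arb :: "('a \<times> 'a) set \<Rightarrow> 'a set \<Rightarrow> 'a \<Rightarrow> ('a \<Rightarrow> 'a) \<Rightarrow> bool" where
  "out_arb E S r p \<longleftrightarrow> r \<in> S \<and> p r = r \<and> (\<forall>v\<in>S - {r}. p v \<in> S \<and> (p v, v) \<in> E) \<and>
    (\<exists>h::'a \<Rightarrow> nat. \<forall>v\<in>S - {r}. h (p v) < h v)"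

text \<open>The root is removed from the domain because \<open>p r = r\<close> is a convention that
  must not make \<open>r\<close> its own child. A tree consisting of \<open>r\<close> alone has the
  leaf \<open>r\<close>.\<close>

definition arb_leaves :: "'a set \<Rightarrow> 'a \<Rightarrow> ('a \<Rightarrow> 'a) \<Rightarrow> 'a set" where
  "arb_leaves S r p = S - p ` (S - {r})"

lemma out_arbI:
  fixes h :: "'a \<Rightarrow> nat"
  assumes "r \<in> S" "p r = r" "\<And>v. v \<in> S \<Longrightarrow> v \<noteq> r \<Longrightarrow> p v \<in> S \<and> (p v, v) \<in> E \<and> h (p v) < h v"
  shows "out_arb E S r p"
  using assms unfolding out_arb_def by blast

lemma out_arbE:
  assumes "out_arb E S r p"
  obtains h :: "'a \<Rightarrow> nat" where "r \<in> S" "p r = r"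
    "\<And>v. v \<in> S \<Longrightarrow> v \<noteq> r \<Longrightarrow> p v \<in> S" "\<And>v. v \<in> S \<Longrightarrow> v \<noteq> r \<Longrightarrow> (p v, v) \<in> E"
    "\<And>v. v \<in> S \<Longrightarrow> v \<noteq> r \<Longrightarrow> h (p v) < h v"
  using assms unfolding out_arb_def by blast

section \<open>Cutting a run into blocks\<close>

text \<open>
  \<open>B\<close> is the set of tops of the blocks, \<open>g t\<close> is the index of the vertex on which the block with top \<open>t\<close>
  hangs (\<open>0\<close> if that vertex lies below all blocks), and \<open>L\<close> collects bottoms of blocks on which nothing hangs. The
  marks \<open>M\<close> stand for the values of \<open>g\<close> at tops above \<open>b\<close>. A block of two is used when \<open>b\<close> is marked: it
  either gains a leaf or consumes two marks while producing only one, which explains the weight \<open>2\<close>.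
\<close>

lemma interval_leaves:
  fixes g :: "nat \<Rightarrow> nat" and M :: "nat set"
  assumes "\<And>t. g t = 0 \<or> g t + 2 \<le> t" "finite M"
  shows "\<exists>B L. B \<subseteq> {1..b} \<and> L \<subseteq> {1..b} - M \<and> (b \<ge> 1 \<longrightarrow> b \<in> B) \<and>
    (\<forall>t. 1 \<le> t \<and> t < b \<longrightarrow> t \<in> B \<or> Suc t \<in> B) \<and>
    (\<forall>t\<in>L. t = 1 \<or> t - 1 \<in> B) \<and> (\<forall>t\<in>B. g t \<notin> L) \<and>
    b \<le> 3 * card L + 2 * card (M \<inter> {1..b})"
  using assms(2)
proof (induction b arbitrary: M rule: less_induct)
  case (less b)
  note g = assms(1)
  consider "b = 0" | "b \<ge> 1" "b \<notin> M" | "b = 1" "b \<in> M" 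
    | "b \<ge> 2" "b \<in> M" by linarith
  then show ?case
  proof cases
    case 1
    then show ?thesis by (intro exI[of _ "{}"]) auto
  next
    case 2
    \<comment> \<open>An unmarked \<open>b\<close> is a block by itself and a leaf. Its weight 3
      pays for the vertex \<open>b\<close> and for the new mark \<open>g b\<close> of weight
      2.\<close>
    have "finite (insert (g b) M)" using less.prems by simp
    from less.IH[OF _ this, of "b - 1"] 2 obtain B L where BL: "B \<subseteq> {1..b-1}" 
      "L \<subseteq> {1..b-1} - insert (g b) M" "b - 1 \<ge> 1 \<longrightarrow> b - 1 \<in> B"
      "\<And>t. 1 \<le> t \<Longrightarrow> t < b - 1 \<Longrightarrow> t \<in> B \<or> Suc t \<in> B" "\<forall>t\<in>L. t = 1 \<or> t - 1 \<in> B"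
      "\<forall>t\<in>B. g t \<notin> L" "b - 1 \<le> 3 * card L + 2 * card (insert (g b) M \<inter> {1..b-1})" 
      by auto
    have f: "finite L" using BL(2) finite_subset by blast
    have Lx: "1 \<le> t \<and> t \<le> b - 1 \<and> t \<notin> M \<and> t \<noteq> g b" if "t \<in> L" for t
      using subsetD[OF BL(2) that] by simp
    have Bx: "1 \<le> t \<and> t \<le> b - 1" if "t \<in> B" for t
      using subsetD[OF BL(1) that] by simp
    have nb: "b \<notin> L" using Lx[of b] 2 by auto
    have "insert (g b) M \<inter> {1..b-1} \<subseteq> insert (g b) (M \<inter> {1..b})" by auto
    then have "card (insert (g b) M \<inter> {1..b-1}) \<le> card (insert (g b) (M \<inter> {1..b}))"
      by (intro card_mono) auto
    also have "\<dots> \<le> Suc (card (M \<inter> {1..b}))" by (simp add: card_insert_if)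
    finally have c: "b \<le> 3 * card (insert b L) + 2 * card (M \<inter> {1..b})"
      using BL(7) f nb by simp
    have gb: "g t \<noteq> b" if "t \<in> insert b B" for t using that g[of t] Bx[of t] 2 by auto
    have gap: "t \<in> insert b B \<or> Suc t \<in> insert b B" if "1 \<le> t" "t < b" for t
      using BL(4)[of t] that by (cases "t < b - 1") (auto simp: not_less dest: le_antisym)
    show ?thesis
    proof (rule exI[of _ "insert b B"], rule exI[of _ "insert b L"], intro conjI)
      show "insert b B \<subseteq> {1..b}" using 2 by (auto dest: Bx)
      show "insert b L \<subseteq> {1..b} - M" using 2 by (auto dest: Lx)
      show "\<forall>t. 1 \<le> t \<and> t < b \<longrightarrow> t \<in> insert b B \<or> Suc t \<in> insert b B" using gap by blast
      show "\<forall>t\<in>insert b L. t = 1 \<or> t - 1 \<in> insert b B" using BL(3,5) 2 by auto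
      show "\<forall>t\<in>insert b B. g t \<notin> insert b L" using BL(6) gb Lx by blast
    qed (use c in auto)
  next
    case 3
    then have "M \<inter> {1..b} = {1}" by auto
    with 3 show ?thesis by (intro exI[of _ "{1}"] exI[of _ "{}"]) auto
  next
    case 4
    \<comment> \<open>The block is \<open>{b - 1, b}\<close>; its bottom is a leaf unless marked. No
      chosen top hangs on \<open>b - 1\<close> in addition, since every top \<open>t\<close>
      satisfies \<open>g t <= b - 2\<close>.\<close>
    define L0 where "L0 = {b - 1} - M"
    have "finite (insert (g b) M)" using less.prems by simp
    from less.IH[OF _ this, of "b - 2"] 4 obtain B L where BL: "B \<subseteq> {1..b-2}" 
      "L \<subseteq> {1..b-2} - insert (g b) M" "b - 2 \<ge> 1 \<longrightarrow> b - 2 \<in> B"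
      "\<And>t. 1 \<le> t \<Longrightarrow> t < b - 2 \<Longrightarrow> t \<in> B \<or> Suc t \<in> B" "\<forall>t\<in>L. t = 1 \<or> t - 1 \<in> B"
      "\<forall>t\<in>B. g t \<notin> L" "b - 2 \<le> 3 * card L + 2 * card (insert (g b) M \<inter> {1..b-2})"
      by auto
    have f: "finite L" using BL(2) finite_subset by blast
    have Lx: "1 \<le> t \<and> t \<le> b - 2 \<and> t \<notin> M \<and> t \<noteq> g b" if "t \<in> L" for t
      using subsetD[OF BL(2) that] by simp
    have Bx: "1 \<le> t \<and> t \<le> b - 2" if "t \<in> B" for t
      using subsetD[OF BL(1) that] by simp
    have dj: "L \<inter> L0 = {}" using 4 by (auto simp: L0_def dest: Lx)
    have cL: "card (L \<union> L0) = card L + card L0"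
      using f dj by (intro card_Un_disjoint) (auto simp: L0_def)
    have "card (insert (g b) M \<inter> {1..b-2}) \<le> card (insert (g b) (M \<inter> {1..b-2}))"
      by (intro card_mono) auto
    also have "\<dots> \<le> Suc (card (M \<inter> {1..b-2}))" by (simp add: card_insert_if)
    finally have c1: "b \<le> 3 * card L + 2 * card (M \<inter> {1..b-2}) + 4" using BL(7) by simp
    have eq: "M \<inter> {1..b} = (M \<inter> {1..b-2}) \<union> (insert b ({b - 1} \<inter> M))" using 4 by auto
    have c2: "card (M \<inter> {1..b}) = card (M \<inter> {1..b-2}) + card (insert b ({b - 1} \<inter> M))"
      unfolding eq using 4 by (intro card_Un_disjoint) auto
    \<comment> \<open>Two vertices and the new mark need weight 4. The marks \<open>b\<close> and
      \<open>b - 1\<close> together supply 4; the mark \<open>b\<close> and the leaf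
      \<open>b - 1\<close> supply 5.\<close>
    have c: "b \<le> 3 * card (L \<union> L0) + 2 * card (M \<inter> {1..b})"
    proof (cases "b - 1 \<in> M")
      case True
      then show ?thesis using c1 c2 cL 4 by simp
    next
      case False
      then have "L0 = {b - 1}" by (auto simp: L0_def)
      then show ?thesis using c1 c2 cL False by simp
    qed
    have gb: "g t \<notin> L0" if "t \<in> insert b B" for t 
      using that g[of t] Bx[of t] 4 by (auto simp: L0_def)
    have gap: "t \<in> insert b B \<or> Suc t \<in> insert b B" if t: "1 \<le> t" "t < b" for t
    proof -
      consider "Suc t = b" | "t = b - 2" "b - 2 \<ge> 1" | "t < b - 2" using t by linarith
      then show ?thesis using BL(3) BL(4)[of t] t by cases auto
    qed
    have bot: "t = 1 \<or> t - 1 \<in> B" if "t \<in> L0" for t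
      using BL(3) that 4 by (auto simp: L0_def numeral_2_eq_2)
    show ?thesis
    proof (rule exI[of _ "insert b B"], rule exI[of _ "L \<union> L0"], intro conjI)
      show "L \<union> L0 \<subseteq> {1..b} - M" using 4 by (auto simp: L0_def dest: Lx)
      show "\<forall>t\<in>L \<union> L0. t = 1 \<or> t - 1 \<in> insert b B" using BL(5) bot by blast
      show "\<forall>t\<in>insert b B. g t \<notin> L \<union> L0" using BL(6) gb Lx by blast
      show "insert b B \<subseteq> {1..b}" using 4 by (auto dest: Bx)
      show "\<forall>t. 1 \<le> t \<and> t < b \<longrightarrow> t \<in> insert b B \<or> Suc t \<in> insert b B" using gap by blast
    qed (use c in auto)
  qed
qed

section \<open>Trees with the maximum number of leaves\<close>

locale strong_rel =
  fixes V :: "'a set" and E :: "('a \<times> 'a) set"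
  assumes finV: "finite V" and E_V: "E \<subseteq> V \<times> V" and irrefl: "(v, v) \<notin> E"
    and strong: "u \<in> V \<Longrightarrow> v \<in> V \<Longrightarrow> (u, v) \<in> E\<^sup>*"
begin

lemma exists_leaving:
  assumes "r \<in> S" "S \<subset> V"
  obtains u v where "u \<in> S" "v \<in> V - S" "(u, v) \<in> E"
proof -
  obtain w where w: "w \<in> V - S" using assms by auto
  have "(r, w) \<in> E\<^sup>*" using strong assms w by auto
  then have "w \<notin> S \<longrightarrow> (\<exists>u v. u \<in> S \<and> v \<in> V - S \<and> (u, v) \<in> E)"
    by (induction rule: rtrancl_induct) (use assms E_V in auto)
  then show thesis using w that by blast
qed

text \<open>Hanging an outside vertex \<open>v\<close> on a tree vertex \<open>u\<close> creates the
  leaf \<open>v\<close> and destroys at most the leaf \<open>u\<close>, so the count never drops.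
  Strong connectivity supplies such an arc until the tree spans \<open>V\<close>.\<close>

lemma out_arb_extend:
  assumes "out_arb E S r p" "S \<subseteq> V"
  shows "\<exists>q. out_arb E V r q \<and> card (arb_leaves S r p) \<le> card (arb_leaves V r q)"
  using assms
proof (induction "card (V - S)" arbitrary: S p rule: less_induct)
  case less
  show ?case
  proof (cases "S = V")
    case True
    then show ?thesis using less.prems by auto
  next
    case False
    have rS: "r \<in> S" using less.prems by (auto simp: out_arb_def)
    with False less.prems obtain u v where uv: "u \<in> S" "v \<in> V - S" "(u, v) \<in> E"
      using exists_leaving[of r S] by blast
    define q where "q = p(v := u)"
    obtain h :: "'a \<Rightarrow> nat" where h: "\<forall>x\<in>S - {r}. h (p x) < h x"
      using less.prems by (auto simp: out_arb_def)
    have old: "p x \<noteq> v" "x \<noteq> v" if "x \<in> S" for x 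
      using that uv less.prems by (auto simp: out_arb_def)
    have oq: "out_arb E (insert v S) r q"
      by (rule out_arbI[where h = "h(v := Suc (h u))"])
        (use less.prems uv rS old h in \<open>auto simp: out_arb_def q_def\<close>)
    have "finite (V - S)" using finV by auto
    then have lt: "card (V - insert v S) < card (V - S)"
      using uv by (intro psubset_card_mono) auto
    obtain q' where q': "out_arb E V r q'"
       "card (arb_leaves (insert v S) r q) \<le> card (arb_leaves V r q')"
      using less.hyps[OF lt oq] less.prems uv by auto
    have fS: "finite S" using less.prems finV finite_subset by blast
    have fin: "finite (arb_leaves S r p)" "finite (arb_leaves (insert v S) r q)"
      using fS by (auto simp: arb_leaves_def)
    have "insert v (arb_leaves S r p - {u}) \<subseteq> arb_leaves (insert v S) r q"
      using uv old by (auto simp: arb_leaves_def q_def image_iff)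
    then have "card (insert v (arb_leaves S r p - {u})) \<le> card (arb_leaves (insert v S) r q)"
      using fin by (intro card_mono) auto
    moreover have "card (insert v (arb_leaves S r p - {u})) = Suc (card (arb_leaves S r p - {u}))"
      using fin uv by (subst card_insert_disjoint) (auto simp: arb_leaves_def)
    moreover have "card (arb_leaves S r p) \<le> Suc (card (arb_leaves S r p - {u}))"
      using fin by (metis card_Suc_Diff1 Diff_empty Diff_insert0 le_SucI order_refl)
    ultimately show ?thesis using q' by (intro exI[of _ q']) simp
  qed
qed

end

text \<open>A fibre of size \<open>c \<ge> 2\<close> loses \<open>c - 1 \<ge> c / 2\<close> points in the image.\<close>

lemma card_non_injective_points:
  assumes "finite W"
  shows "card {v\<in>W. \<exists>x\<in>W. x \<noteq> v \<and> p x = p v} \<le> 2 * (card W - card (p ` W))"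
proof -
  define Q where "Q = {v\<in>W. \<exists>x\<in>W. x \<noteq> v \<and> p x = p v}"
  have fQ: "finite Q" "Q \<subseteq> W" using assms by (auto simp: Q_def)
  have "inj_on p (W - Q)" by (auto simp: inj_on_def Q_def)
  then have 1: "card (p ` (W - Q)) = card W - card Q"
    using fQ by (simp add: card_image card_Diff_subset)
  have "p ` W = p ` (W - Q) \<union> p ` Q" using fQ by auto
  moreover have "p ` (W - Q) \<inter> p ` Q = {}" by (auto simp: Q_def) metis
  ultimately have 2: "card (p ` W) = card W - card Q + card (p ` Q)"
    using assms fQ 1 by (simp add: card_Un_disjoint)
  have two: "2 \<le> card {v\<in>Q. p v = y}" if y: "y \<in> p ` Q" for y
  proof -
    obtain v where v: "v \<in> W" "p v = y" "v \<in> Q" using y fQ by auto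
    then obtain x where x: "x \<in> W" "x \<noteq> v" "p x = p v" unfolding Q_def by auto
    note vx = v(1) x v(2)
    then have "{v, x} \<subseteq> {v\<in>Q. p v = y}" unfolding Q_def by auto
    then have "card {v, x} \<le> card {v\<in>Q. p v = y}" using fQ by (intro card_mono) auto
    then show ?thesis using vx by simp
  qed
  have "card (p ` Q) * 2 \<le> (\<Sum>y\<in>p ` Q. card {v\<in>Q. p v = y})"
    using sum_bounded_below[of "p ` Q" 2 "\<lambda>y. card {v\<in>Q. p v = y}"] two by simp
  also have "\<dots> = card (\<Union>y\<in>p ` Q. {v\<in>Q. p v = y})"
    using fQ by (intro card_UN_disjoint[symmetric]) auto
  also have "(\<Union>y\<in>p ` Q. {v\<in>Q. p v = y}) = Q" by auto
  finally show ?thesis using 2 card_mono[OF assms fQ(2)] unfolding Q_def[symmetric] by linarith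
qed

text \<open>\<open>maximal\<close> ranges over all roots \<open>s\<close>, since competing trees may
  be rooted elsewhere. \<open>extra_in_nbr\<close> is the common consequence of both degree
  conditions; it is applied with \<open>w\<close> a child and \<open>u\<close> the parent of
  \<open>v\<close>.\<close>

locale max_arb = strong_rel +
  fixes r :: 'a and p :: "'a \<Rightarrow> 'a"
  assumes arb: "out_arb E V r p"
    and maximal: "out_arb E V s q \<Longrightarrow> card (arb_leaves V s q) \<le> card (arb_leaves V r p)"
    and extra_in_nbr: "(v, w) \<in> E \<Longrightarrow> \<exists>x. (x, v) \<in> E \<and> x \<noteq> w \<and> x \<noteq> u"
begin

abbreviation "Lf \<equiv> arb_leaves V r p"

text \<open>Moving an only child \<open>v\<close> elsewhere turns \<open>p v\<close> into a new
  leaf, and if no in-neighbour of \<open>v\<close> is a leaf, the move destroys none.\<close>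

definition good :: "'a \<Rightarrow> bool" where
  "good v \<longleftrightarrow> v \<in> V - {r} \<and> (\<forall>x\<in>V - {r}. p x = p v \<longrightarrow> x = v) \<and> (\<forall>x\<in>Lf. (x, v) \<notin> E)"

lemma root_in_V: "r \<in> V" and parent_root: "p r = r"
  and parent_E: "v \<in> V \<Longrightarrow> v \<noteq> r \<Longrightarrow> (p v, v) \<in> E"
  using arb by (auto simp: out_arb_def)

lemma parent_in_V: "v \<in> V \<Longrightarrow> p v \<in> V"
  using arb by (cases "v = r") (auto simp: out_arb_def)

lemma ancestor_in_V: "v \<in> V \<Longrightarrow> (p ^^ t) v \<in> V"
  by (induction t) (auto simp: parent_in_V)

lemma ancestor_root: "(p ^^ t) r = r"
  by (induction t) (auto simp: parent_root)

lemma finite_Lf: "finite Lf" 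
  using finV by (simp add: arb_leaves_def)

lemma partial_leaves:
  assumes "out_arb E S s q" "S \<subseteq> V"
  shows "card (arb_leaves S s q) \<le> card Lf"
  using out_arb_extend[OF assms] maximal order_trans by blast

lemma out_nbrs_le:
  assumes "x \<in> V"
  shows "card (E `` {x}) \<le> card Lf"
proof -
  have S: "insert x (E `` {x}) \<subseteq> V" using assms E_V by auto
  have "out_arb E (insert x (E `` {x})) x (\<lambda>_. x)"
    by (rule out_arbI[where h = "\<lambda>v. if v = x then 0 else 1"]) auto
  from partial_leaves[OF this S]
  have "card (arb_leaves (insert x (E `` {x})) x (\<lambda>_. x)) \<le> card Lf" .
  moreover have "E `` {x} \<subseteq> arb_leaves (insert x (E `` {x})) x (\<lambda>_. x)"
    using irrefl by (auto simp: arb_leaves_def)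
  moreover have "finite (arb_leaves (insert x (E `` {x})) x (\<lambda>_. x))"
    using S finV finite_subset by (auto simp: arb_leaves_def)
  ultimately show ?thesis using card_mono order_trans by blast
qed

text \<open>With \<open>l = card Lf\<close> the bound is \<open>1 + 2 * l + l * l\<close>: the root,
  the vertices with siblings, and the out-neighbours of leaves.\<close>

lemma card_not_good: "card {v\<in>V. \<not> good v} \<le> (card Lf + 1)\<^sup>2"
proof -
  define Q where "Q = {v\<in>V - {r}. \<exists>x\<in>V - {r}. x \<noteq> v \<and> p x = p v}"
  have sub: "{v\<in>V. \<not> good v} \<subseteq> {r} \<union> Q \<union> (\<Union>x\<in>Lf. E `` {x})"
    by (auto simp: good_def Q_def)
  have fE: "finite (E `` {x})" for x using E_V finV by (metis Image_subset finite_subset)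
  have IV: "p ` (V - {r}) \<subseteq> V" using parent_in_V by auto
  \<comment> \<open>The number of points lost under \<open>p\<close> is at most the number of
    childless vertices; this bounds the vertices with siblings.\<close>
  have "card Lf = card V - card (p ` (V - {r}))"
    unfolding arb_leaves_def using IV finV by (simp add: card_Diff_subset finite_subset)
  moreover have "card (p ` (V - {r})) \<le> card V" using IV finV by (rule card_mono[rotated])
  moreover have "card (V - {r}) \<le> card V" using finV by (simp add: card_mono)
  ultimately have "card Q \<le> 2 * card Lf"
    using card_non_injective_points[of "V - {r}" p] finV unfolding Q_def by simp
  moreover have "card (\<Union>x\<in>Lf. E `` {x}) \<le> card Lf * card Lf"
  proof -
    have "card (\<Union>x\<in>Lf. E `` {x}) \<le> (\<Sum>x\<in>Lf. card (E `` {x}))"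
      using finite_Lf by (rule card_UN_le)
    also have "\<dots> \<le> card Lf * card Lf"
      using sum_bounded_above[of Lf "\<lambda>x. card (E `` {x})" "card Lf"] out_nbrs_le
      by (simp add: arb_leaves_def)
    finally show ?thesis .
  qed
  moreover have "card {v\<in>V. \<not> good v} \<le> card ({r} \<union> Q \<union> (\<Union>x\<in>Lf. E `` {x}))"
    using sub finV finite_Lf fE by (intro card_mono) (auto simp: Q_def)
  moreover have "card ({r} \<union> Q \<union> (\<Union>x\<in>Lf. E `` {x})) \<le> 1 + card Q + card (\<Union>x\<in>Lf. E `` {x})"
    using card_Un_le[of "{r} \<union> Q" "\<Union>x\<in>Lf. E `` {x}"] card_Un_le[of "{r}" Q] by simp
  ultimately show ?thesis by (simp add: power2_eq_square)
qed

section \<open>Runs of good vertices: counting by runs and bounding their length\<close>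

lemma good_run_inj:
  assumes "(p ^^ d) v = (p ^^ d) v'"
    and "\<And>i. i < d \<Longrightarrow> good ((p ^^ i) v) \<and> good ((p ^^ i) v')"
  shows "v = v'"
  using assms
proof (induction d)
  case (Suc d)
  \<comment> \<open>A good vertex is the only child of its parent, so equality after
    \<open>d + 1\<close> steps gives equality after \<open>d\<close> steps.\<close>
  have "good ((p ^^ d) v)" "good ((p ^^ d) v')" "p ((p ^^ d) v') = p ((p ^^ d) v)"
    using Suc.prems by auto
  then have "(p ^^ d) v = (p ^^ d) v'" unfolding good_def by metis
  then show ?case using Suc by auto
qed simp

text \<open>Walking up to the first bad vertex encodes \<open>v\<close> by the number of steps,
  below \<open>N\<close>, and the vertex reached. Retracing the run through only children recovers
  \<open>v\<close>, so the code is injective.\<close>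

lemma card_le_runs:
  assumes "\<And>v. v \<in> V \<Longrightarrow> \<exists>t<N. \<not> good ((p ^^ t) v)"
  shows "card V \<le> N * card {v\<in>V. \<not> good v}"
proof -
  define d where "d v = (LEAST t. \<not> good ((p ^^ t) v))" for v
  have d: "d v < N" "\<not> good ((p ^^ d v) v)" "i < d v \<Longrightarrow> good ((p ^^ i) v)" if v: "v \<in> V" for v i
  proof -
    obtain t where "t < N" "\<not> good ((p ^^ t) v)" using assms v by blast
    then show "d v < N" unfolding d_def by (meson Least_le le_less_trans)
    show "\<not> good ((p ^^ d v) v)" unfolding d_def by (rule LeastI) fact
    show "i < d v \<Longrightarrow> good ((p ^^ i) v)" unfolding d_def using not_less_Least by blast
  qed
  have "inj_on (\<lambda>v. (d v, (p ^^ d v) v)) V"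
    by (rule inj_onI) (metis Pair_inject d(3) good_run_inj)
  moreover have "(\<lambda>v. (d v, (p ^^ d v) v)) ` V \<subseteq> {..<N} \<times> {v\<in>V. \<not> good v}"
    using d ancestor_in_V by auto
  ultimately have "card V \<le> card ({..<N} \<times> {v\<in>V. \<not> good v})"
    using finV by (intro card_inj_on_le) auto
  then show ?thesis by (simp add: card_cartesian_product)
qed

text \<open>Take an in-neighbour other than \<open>w\<close> and \<open>p v\<close>. If it were not
  below \<open>v\<close>, rehanging \<open>v\<close> on it would give a tree with more leaves.
  Avoiding the child \<open>w\<close> later keeps the top of a block from hanging on the vertex
  right below it.\<close>

lemma good_descendant_in_nbr:
  assumes v: "good v" and w: "w \<in> V" "w \<noteq> r" "p w = v"
  shows "\<exists>x m. (x, v) \<in> E \<and> x \<noteq> w \<and> x \<noteq> v \<and> (p ^^ m) x = v"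
proof -
  have vV: "v \<in> V" "v \<noteq> r" using v by (auto simp: good_def)
  have "(v, w) \<in> E" using parent_E w by auto
  then obtain x where x: "(x, v) \<in> E" "x \<noteq> w" "x \<noteq> p v"
    using extra_in_nbr by blast
  have xV: "x \<in> V" "x \<noteq> v" using x E_V irrefl by auto
  have xL: "x \<notin> Lf" using v x by (auto simp: good_def)
  have "\<exists>m. (p ^^ m) x = v"
  proof (rule ccontr)
    assume nd: "\<nexists>m. (p ^^ m) x = v"
    define D where "D = {y. \<exists>m. (p ^^ m) y = v}"
    define q where "q = p(v := x)"
    obtain h :: "'a \<Rightarrow> nat" where h: "\<forall>y\<in>V - {r}. h (p y) < h y"
      using arb by (auto simp: out_arb_def)
    have vD: "v \<in> D" unfolding D_def by (metis (mono_tags) funpow_0 mem_Collect_eq)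
    have xD: "x \<notin> D" using nd by (simp add: D_def)
    have pD: "p y \<in> D \<longleftrightarrow> y \<in> D" if "y \<noteq> v" for y
    proof
      assume "p y \<in> D"
      then obtain m where "(p ^^ m) (p y) = v" by (auto simp: D_def)
      then have "(p ^^ Suc m) y = v" by (simp add: funpow_Suc_right del: funpow.simps)
      then show "y \<in> D" unfolding D_def by blast
    next
      assume "y \<in> D"
      then obtain m where m: "(p ^^ m) y = v" by (auto simp: D_def)
      with that obtain m' where "m = Suc m'" by (cases m) auto
      with m have "(p ^^ m') (p y) = v" by (simp add: funpow_Suc_right del: funpow.simps)
      then show "p y \<in> D" unfolding D_def by blast
    qed
    have arbq: "out_arb E V r q"
    \<comment> \<open>Among the new parent arcs only \<open>(x, v)\<close> joins \<open>D\<close>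
      and its complement. Raising all ranks in \<open>D\<close> by \<open>h x + 1\<close> makes rank
      increase along it and changes nothing for the others.\<close>
    proof (rule out_arbI[where h = "\<lambda>y. if y \<in> D then h y + h x + 1 else h y"])
      show "r \<in> V" "q r = r" using root_in_V parent_root vV by (auto simp: q_def)
      fix y assume y: "y \<in> V" "y \<noteq> r"
      show "q y \<in> V \<and> (q y, y) \<in> E \<and> (if q y \<in> D then h (q y) + h x + 1 else h (q y))
        < (if y \<in> D then h y + h x + 1 else h y)"
        using y parent_in_V parent_E h x xV vD xD pD by (cases "y = v") (auto simp: q_def)
    qed
    \<comment> \<open>\<open>p v\<close> loses its only child \<open>v\<close>, which now hangs on
      \<open>x\<close>, different from \<open>p v\<close>.\<close>
    have pvq: "p v \<notin> q ` (V - {r})"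
    proof
      assume "p v \<in> q ` (V - {r})"
      then obtain y where y: "p v = q y" "y \<in> V - {r}" by auto
      show False
      proof (cases "y = v")
        case True
        then show ?thesis using y x(3) by (simp add: q_def)
      next
        case False
        then show ?thesis using y v unfolding good_def by (metis fun_upd_other q_def)
      qed
    qed
    have qsub: "q ` (V - {r}) \<subseteq> insert x (p ` (V - {r}))" by (auto simp: q_def)
    have "y \<in> arb_leaves V r q" if y: "y \<in> insert (p v) Lf" for y
    proof (cases "y = p v")
      case True
      then show ?thesis using pvq parent_in_V[OF vV(1)] by (simp add: arb_leaves_def)
    next
      case False
      then have "y \<in> Lf" "y \<noteq> x" using y xL by auto
      then show ?thesis using qsub unfolding arb_leaves_def by (metis Diff_iff insertE subsetD)
    qed
    then have "insert (p v) Lf \<subseteq> arb_leaves V r q" by (rule subsetI)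
    moreover have "p v \<notin> Lf" using vV by (auto simp: arb_leaves_def)
    moreover have "finite (arb_leaves V r q)" using finV by (simp add: arb_leaves_def)
    ultimately have "Suc (card Lf) \<le> card (arb_leaves V r q)"
      using finite_Lf card_mono[of "arb_leaves V r q" "insert (p v) Lf"] by simp
    then show False using maximal[OF arbq] by simp
  qed
  then show ?thesis using x xV by blast
qed

text \<open>For \<open>d = b + 1\<close> the competing tree is rooted at \<open>v = u 0\<close>,
  keeps the subtree \<open>D\<close> below \<open>v\<close> and rearranges
  \<open>u 1, ..., u b\<close> so that at least a third of these are leaves. The vertex
  \<open>u 0\<close> accounts for the \<open>+ 1\<close>.\<close>

lemma good_run_le:
  assumes v: "v \<in> V" and run: "\<And>t. t < d \<Longrightarrow> good ((p ^^ t) v)"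
  shows "d \<le> 3 * card Lf + 1"
proof (cases d)
  case (Suc b)
  define u where "u t = (p ^^ t) v" for t
  have u0: "u 0 = v" and uS: "u (Suc t) = p (u t)" for t by (auto simp: u_def)
  have ug: "good (u t)" if "t \<le> b" for t using that run Suc by (simp add: u_def)
  have uV: "u t \<in> V" for t using ancestor_in_V v by (simp add: u_def)
  have ur: "u t \<noteq> r" if "t \<le> b" for t using ug[OF that] by (simp add: good_def)
  obtain h :: "'a \<Rightarrow> nat" where h: "\<And>y. y \<in> V \<Longrightarrow> y \<noteq> r \<Longrightarrow> h (p y) < h y"
    using arb by (auto simp: out_arb_def)
  have hle: "h (p y) \<le> h y" if "y \<in> V" for y using h[OF that] parent_root by (cases "y = r") auto
  have hpow: "h ((p ^^ m) y) \<le> h y" if "y \<in> V" for m y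
  proof (induction m)
    case (Suc m)
    show ?case using hle[OF ancestor_in_V[OF that], of m] Suc by simp
  qed simp
  have hu: "h (u t) < h (u s)" if "s < t" "t \<le> b" for s t
    using that
  proof (induction t)
    case (Suc t)
    have "h (u (Suc t)) < h (u t)" using h uV ur Suc by (auto simp: uS)
    then show ?case using Suc by (cases "s = t") auto
  qed simp
  have inj: "inj_on u {..b}"
    by (rule inj_onI) (metis atMost_iff hu less_irrefl nat_neq_iff)
  define D where "D = {y\<in>V. \<exists>m. (p ^^ m) y = v}"
  have vD: "v \<in> D" unfolding D_def using v by (metis (mono_tags, lifting) funpow_0 mem_Collect_eq)
  have rD: "r \<notin> D" using ancestor_root ur[of 0] u0 by (auto simp: D_def)
  have uD: "u t \<notin> D" if "t \<in> {1..b}" for t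
  proof
    assume "u t \<in> D"
    then obtain m where "(p ^^ m) (u t) = v" by (auto simp: D_def)
    then have "h v \<le> h (u t)" using hpow[OF uV, of m t] by simp
    then show False using hu[of 0 t] that by (simp add: u0)
  qed
  have pD: "p y \<in> D" if y: "y \<in> D" "y \<noteq> v" for y
  proof -
    obtain m where m: "(p ^^ m) y = v" using y by (auto simp: D_def)
    with y obtain m' where "m = Suc m'" by (cases m) auto
    with m have "(p ^^ m') (p y) = v" by (simp add: funpow_Suc_right del: funpow.simps)
    then show ?thesis using y parent_in_V unfolding D_def by blast
  qed
  \<comment> \<open>A descendant of \<open>u (t + 1)\<close> is that vertex or lies below its only
    child \<open>u t\<close>; descending step by step ends in \<open>D\<close>.\<close>
  have desc: "y \<in> D \<or> (\<exists>s. 1 \<le> s \<and> s \<le> t \<and> y = u s)"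
    if "y \<in> V" "(p ^^ m) y = u t" "t \<le> b" for y m t
    using that
  proof (induction t arbitrary: m)
    case 0
    then show ?case by (auto simp: D_def u0)
  next
    case (Suc t)
    show ?case
    proof (cases m)
      case 0
      then show ?thesis using Suc.prems by auto
    next
      case (Suc m')
      let ?z = "(p ^^ m') y"
      have z: "p ?z = p (u t)" "?z \<in> V" using Suc Suc.prems ancestor_in_V by (auto simp: uS)
      then have "?z \<noteq> r" using parent_root ur[OF Suc.prems(3)] uS by auto
      then have "?z = u t" using z ug[of t] Suc.prems unfolding good_def by auto
      from Suc.IH[OF Suc.prems(1) this] Suc.prems show ?thesis by (auto intro: le_SucI)
    qed
  qed
  \<comment> \<open>The value \<open>s = 0\<close> codes an in-neighbour in \<open>D\<close>. One on
    the run is at least two places down, as \<open>u t\<close> and \<open>u (t - 1)\<close> are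
    avoided.\<close>
  have "\<exists>x s. (x, u t) \<in> E \<and> (x \<in> D \<and> s = 0 \<or> 1 \<le> s \<and> s + 2 \<le> t \<and> x = u s)"
    if t: "t \<in> {1..b}" for t
  proof -
    have st: "Suc (t - 1) = t" using t by auto
    have "p (u (t - 1)) = u t" using uS[of "t - 1"] st by simp
    moreover have "t \<le> b" "t - 1 \<le> b" using t by auto
    ultimately obtain x m where x: "(x, u t) \<in> E" "x \<noteq> u (t - 1)" "x \<noteq> u t" "(p ^^ m) x = u t"
      using good_descendant_in_nbr[OF ug uV ur, of t "t - 1"] by auto
    have "x \<in> V" using x E_V by auto
    then consider "x \<in> D" | s where "1 \<le> s" "s \<le> t" "x = u s"
      using desc[OF _ x(4)] t by (meson atLeastAtMost_iff)
    then show ?thesis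
    proof cases
      case 1
      then show ?thesis using x by blast
    next
      case 2
      then have "s \<noteq> t" "s \<noteq> t - 1" using x by auto
      then show ?thesis using 2 x(1) by (intro exI[of _ x] exI[of _ s]) auto
    qed
  qed
  then obtain f g0 where fg: "\<And>t. t \<in> {1..b} \<Longrightarrow> (f t, u t) \<in> E \<and> 
     (f t \<in> D \<and> g0 t = 0 \<or> 1 \<le> g0 t \<and> g0 t + 2 \<le> t \<and> f t = u (g0 t))" by metis
  \<comment> \<open>\<open>interval_leaves\<close> constrains \<open>g\<close> at every argument,
    whereas \<open>g0\<close> is controlled only on \<open>{1..b}\<close>.\<close>
  define g where "g t = (if t \<in> {1..b} then g0 t else (0::nat))" for t
  have g: "g t = 0 \<or> g t + 2 \<le> t" for t using fg[of t] by (auto simp: g_def)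
  from interval_leaves[of g "{}" b, OF g] obtain B L where BL: "B \<subseteq> {1..b}" "L \<subseteq> {1..b}"
    "b \<ge> 1 \<longrightarrow> b \<in> B" "\<And>t. 1 \<le> t \<Longrightarrow> t < b \<Longrightarrow> t \<in> B \<or> Suc t \<in> B"
    "\<And>t. t \<in> L \<Longrightarrow> t = 1 \<or> t - 1 \<in> B" "\<And>t. t \<in> B \<Longrightarrow> g t \<notin> L" "b \<le> 3 * card L"
    by auto
  define idx where "idx = inv_into {1..b} u"
  have idx: "idx (u t) = t" if "t \<in> {1..b}" for t
    unfolding idx_def using that inj by (intro inv_into_f_f) (auto intro: inj_on_subset)
  define q where "q y = (if y = v then v else if y \<in> D then p y
    else if idx y \<in> B then f (idx y) else u (Suc (idx y)))" for y
  define K where "K = (\<Sum>y\<in>V. h y)"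
  have K: "h y \<le> K" if "y \<in> V" for y unfolding K_def using finV that by (intro member_le_sum) auto
  \<comment> \<open>Ranks in \<open>D\<close> are at most \<open>K\<close>. A top \<open>t\<close>
    hangs on \<open>D\<close> or on some \<open>s <= t - 2\<close>, and
    \<open>2 * s + 3 < 2 * t\<close>. A lower vertex \<open>t\<close> of a block hangs on the top
    \<open>t + 1\<close>, and \<open>2 * (t + 1) < 2 * t + 3\<close>.\<close>
  define H where "H y = (if y \<in> D then h y else K + (if idx y \<in> B then 2 * idx y else 2 * idx y + 3))" for y
  define S where "S = D \<union> u ` {1..b}"
  have S: "S \<subseteq> V" using uV by (auto simp: S_def D_def)
  have HD: "H y = h y" if "y \<in> D" for y using that by (simp add: H_def)
  have Hu: "H (u t) = K + (if t \<in> B then 2 * t else 2 * t + 3)" if "t \<in> {1..b}" for t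
    using that uD idx by (simp add: H_def)
  have quB: "q (u t) = f t" if "t \<in> B" for t
    using that BL(1) uD[of t] idx[of t] vD by (auto simp: q_def)
  have qun: "q (u t) = u (Suc t)" if "t \<in> {1..b}" "t \<notin> B" for t
    using that uD[of t] idx[of t] vD by (auto simp: q_def)
  have gap: "Suc t \<in> B" if "t \<in> {1..b}" "t \<notin> B" for t
    using that BL(3) BL(4)[of t] by (cases "t = b") auto
  have arbq: "out_arb E S v q"
  proof (rule out_arbI[where h = H])
    show "v \<in> S" "q v = v" using vD by (auto simp: S_def q_def)
    fix y assume y: "y \<in> S" "y \<noteq> v"
    show "q y \<in> S \<and> (q y, y) \<in> E \<and> H (q y) < H y"
    proof (cases "y \<in> D")
      case True
      then have "q y = p y" "y \<noteq> r" "y \<in> V" using y rD by (auto simp: q_def D_def)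
      then show ?thesis using pD[OF True y(2)] True parent_E h HD by (auto simp: S_def)
    next
      case False
      then obtain t where t: "t \<in> {1..b}" "y = u t" using y by (auto simp: S_def)
      show ?thesis
      proof (cases "t \<in> B")
        case True
        show ?thesis
        proof (cases "f t \<in> D")
          case fD: True
          then have "h (f t) \<le> K" using K by (auto simp: D_def)
          then show ?thesis using fD fg[OF t(1)] t quB[OF True] Hu True HD by (auto simp: S_def)
        next
          case False
          then have gt: "f t = u (g0 t)" "1 \<le> g0 t" "g0 t + 2 \<le> t" using fg[OF t(1)] by auto
          then have "g0 t \<in> {1..b}" using t by auto
          then show ?thesis using gt fg[OF t(1)] t quB[OF True] Hu True by (auto simp: S_def)
        qed
      next
        case False
        note sB = gap[OF t(1) False]
        have "Suc t \<in> {1..b}" using sB BL(1) by auto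
        moreover have "(u (Suc t), u t) \<in> E" using parent_E uV ur t by (auto simp: uS)
        ultimately show ?thesis using t qun[OF t(1) False] Hu sB False by (auto simp: S_def)
      qed
    qed
  qed
  have "u ` L \<subseteq> arb_leaves S v q"
  proof
    fix y assume "y \<in> u ` L"
    then obtain t where t: "t \<in> L" "y = u t" by auto
    have tb: "t \<in> {1..b}" using t BL(2) by auto
    \<comment> \<open>A child \<open>u s\<close> of \<open>u t\<close> would be a top with
      \<open>g0 s = t\<close>, which the choice of \<open>L\<close> forbids, or the lower vertex of
      a block with top \<open>t\<close>, although \<open>t\<close> is itself a bottom.\<close>
    have "q z \<noteq> u t" if z: "z \<in> S" "z \<noteq> v" for z
    proof (cases "z \<in> D")
      case True
      then show ?thesis using pD[OF True z(2)] uD[OF tb] z by (auto simp: q_def)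
    next
      case False
      then obtain s where s: "s \<in> {1..b}" "z = u s" using z by (auto simp: S_def)
      show ?thesis
      proof (cases "s \<in> B")
        case True
        then have "g0 s \<noteq> t" using BL(6)[OF True] t s by (auto simp: g_def)
        then show ?thesis using fg[OF s(1)] quB[OF True] s uD[OF tb] inj_onD[OF inj] tb by fastforce
      next
        case False
        have "Suc s \<noteq> t" using BL(5)[OF t(1)] False s by auto
        moreover have "Suc s \<le> b" using gap[OF s(1) False] BL(1) by auto
        ultimately show ?thesis using qun[OF s(1) False] s inj_onD[OF inj, of "Suc s" t] tb by auto
      qed
    qed
    then have "u t \<notin> q ` (S - {v})" by (metis DiffE imageE insertI1)
    then show "y \<in> arb_leaves S v q" using t tb by (auto simp: arb_leaves_def S_def)
  qed
  moreover have "finite (arb_leaves S v q)" using S finV finite_subset by (auto simp: arb_leaves_def)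
  ultimately have "card (u ` L) \<le> card Lf"
    using partial_leaves[OF arbq S] card_mono order_trans by blast
  moreover have "card (u ` L) = card L"
    by (intro card_image inj_on_subset[OF inj] subset_trans[OF BL(2)]) auto
  ultimately show ?thesis using BL(7) Suc by simp
qed simp

lemma card_le_cube: "card V \<le> 4 * (card Lf + 1) ^ 3"
proof -
  let ?k = "card Lf + 1"
  \<comment> \<open>\<open>4 * ?k\<close> exceeds the largest possible run length
    \<open>3 * card Lf + 1\<close>.\<close>
  have "\<exists>t<4 * ?k. \<not> good ((p ^^ t) v)" if "v \<in> V" for v
    using good_run_le[OF that, of "4 * ?k"] by auto
  then have "card V \<le> 4 * ?k * card {v\<in>V. \<not> good v}" by (rule card_le_runs)
  also have "\<dots> \<le> 4 * ?k * ?k\<^sup>2" using card_not_good by (rule mult_le_mono2)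
  finally show ?thesis by (simp only: power3_eq_cube power2_eq_square mult.assoc)
qed

end

section \<open>Parent functions as out-branchings\<close>

lemma cas_awalk_verts:
  "pre_digraph.cas G u c v \<Longrightarrow> pre_digraph.awalk_verts G u c = u # map (head G) c"
  by (induction c arbitrary: u) (auto simp: pre_digraph.cas.simps pre_digraph.awalk_verts.simps)

lemma cas_head_tail:
  "pre_digraph.cas G u c v \<Longrightarrow> i < length c \<Longrightarrow>
    head G (c ! i) = (if Suc i = length c then v else tail G (c ! Suc i))"
proof (induction c arbitrary: u i)
  case (Cons e c)
  then show ?case
    by (cases i; cases c) (auto simp: pre_digraph.cas.simps)
qed simp

lemma cas_hd:
  "pre_digraph.cas G u c v \<Longrightarrow> c \<noteq> [] \<Longrightarrow> tail G (c ! 0) = u"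
  by (cases c) (auto simp: pre_digraph.cas.simps)

text \<open>The vertex of largest rank on a cycle has its parent as predecessor and as successor.\<close>

lemma parent_graph_cycle_length:
  fixes h :: "'a \<Rightarrow> nat"
  assumes par: "\<And>e. e \<in> arcs T \<Longrightarrow> tail T e = p (head T e) \<and> h (tail T e) < h (head T e)"
    and cyc: "pre_digraph.cycle (with_proj (mk_symmetric T)) c"
  shows "length c < 3"
proof (rule ccontr)
  assume "\<not> length c < 3"
  define m where "m = length c"
  have m3: "m \<ge> 3" using \<open>\<not> length c < 3\<close> by (simp add: m_def)
  let ?G = "with_proj (mk_symmetric T)"
  obtain u where c: "set c \<subseteq> parcs (mk_symmetric T)" "pre_digraph.cas ?G u c u"
      "distinct (tl (pre_digraph.awalk_verts ?G u c))"
    using cyc unfolding pre_digraph.cycle_def pre_digraph.awalk_def by auto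
  have dist: "distinct (map snd c)"
    using c(3) cas_awalk_verts[OF c(2)] by simp
  have step: "b = p a \<and> h b < h a \<or> a = p b \<and> h a < h b" if "(a, b) \<in> set c" for a b
    using c(1) that par by (fastforce simp: parcs_mk_symmetric)
  have step': "fst (c ! i) = p (snd (c ! i)) \<or> snd (c ! i) = p (fst (c ! i)) \<and> h (snd (c ! i)) < h (fst (c ! i))"
    "snd (c ! i) = p (fst (c ! i)) \<or> h (fst (c ! i)) < h (snd (c ! i))" if "i < m" for i
    using step[of "fst (c ! i)" "snd (c ! i)"] that by (auto simp: m_def)
  define next_i where "next_i i = (if Suc i = m then 0 else Suc i)" for i
  have nxt: "next_i i < m" "fst (c ! next_i i) = snd (c ! i)" if "i < m" for i
  proof -
    show "next_i i < m" using that m3 by (auto simp: next_i_def)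
    show "fst (c ! next_i i) = snd (c ! i)"
    proof (cases "Suc i = m")
      case True
      moreover have "c \<noteq> []" using m3 by (auto simp: m_def)
      ultimately show ?thesis
        using cas_head_tail[OF c(2), of i] cas_hd[OF c(2)] by (simp add: next_i_def m_def)
    next
      case False
      then show ?thesis using cas_head_tail[OF c(2), of i] that by (simp add: next_i_def m_def)
    qed
  qed
  obtain i where i: "i < m" "\<And>j. j < m \<Longrightarrow> h (snd (c ! j)) \<le> h (snd (c ! i))"
  proof -
    let ?H = "(\<lambda>i. h (snd (c ! i))) ` {..<m}"
    have "snd (c ! 0) \<in> (\<lambda>i. snd (c ! i)) ` {..<m}" using m3 by auto
    then have "?H \<noteq> {}" "finite ?H" by auto
    then have "Max ?H \<in> ?H" "\<And>j. j < m \<Longrightarrow> h (snd (c ! j)) \<le> Max ?H" by auto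
    then obtain i where "i < m" "Max ?H = h (snd (c ! i))" by auto
    with \<open>\<And>j. j < m \<Longrightarrow> h (snd (c ! j)) \<le> Max ?H\<close> show thesis by (intro that[of i]) simp_all
  qed
  define prev where "prev = (if i = 0 then m - 1 else i - 1)"
  have prev: "prev < m" "next_i prev = i" using i(1) m3 by (auto simp: prev_def next_i_def)
  have "h (fst (c ! i)) \<le> h (snd (c ! i))"
    using i(2)[OF prev(1)] nxt(2)[OF prev(1)] prev(2) by simp
  then have "fst (c ! i) = p (snd (c ! i))" using step'(1)[OF i(1)] by auto
  moreover have "snd (c ! next_i i) = p (fst (c ! next_i i))"
    using step'(2)[OF nxt(1)[OF i(1)]] i(2)[OF nxt(1)[OF i(1)]] nxt(2)[OF i(1)] by auto
  ultimately have "snd (c ! prev) = snd (c ! next_i i)"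
    using nxt(2)[OF i(1)] nxt(2)[OF prev(1)] prev(2) by simp
  \<comment> \<open>Each vertex is the head of only one arc of the cycle, so the positions before
    and after \<open>i\<close> agree modulo \<open>m\<close>, which is impossible for
    \<open>m >= 3\<close>.\<close>
  then have "prev = next_i i"
    using dist prev(1) nxt(1)[OF i(1)] by (metis distinct_conv_nth length_map m_def nth_map)
  then show False using m3 i(1) by (auto simp: prev_def next_i_def split: if_splits)
qed

definition arb_digraph :: "('a, 'b) pre_digraph \<Rightarrow> 'a \<Rightarrow> ('a \<Rightarrow> 'a) \<Rightarrow> ('a, 'b) pre_digraph" where
  "arb_digraph D r p = \<lparr>verts = verts D, arcs = {e \<in> arcs D. head D e \<noteq> r \<and> tail D e = p (head D e)},
    tail = tail D, head = head D\<rparr>"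

lemma arb_digraph_simps:
  "verts (arb_digraph D r p) = verts D"
  "arcs (arb_digraph D r p) = {e \<in> arcs D. head D e \<noteq> r \<and> tail D e = p (head D e)}"
  "tail (arb_digraph D r p) = tail D" "head (arb_digraph D r p) = head D"
  "arc_to_ends (arb_digraph D r p) = arc_to_ends D"
  by (simp_all add: arb_digraph_def arc_to_ends_def fun_eq_iff)

context
  fixes D :: "('a, 'b) pre_digraph" and r p
  assumes D: "digraph D" and arb: "out_arb (arcs_ends D) (verts D) r p"
begin

interpretation D: digraph D by (rule D)

abbreviation (input) "T \<equiv> arb_digraph D r p"

lemma parent_arc:
  assumes "v \<in> verts D" "v \<noteq> r"
  obtains e where "e \<in> arcs T" "head D e = v" "tail D e = p v"
proof -
  have "(p v, v) \<in> arcs_ends D" using arb assms by (elim out_arbE)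
  then obtain e where "e \<in> arcs D" "tail D e = p v" "head D e = v" by (auto simp: arcs_ends_conv)
  with that[of e] assms show thesis by (simp add: arb_digraph_simps)
qed

lemma digraph_arb: "digraph T"
proof
  have *: "e \<in> arcs D" if "e \<in> arcs T" for e using that by (simp add: arb_digraph_simps(2))
  show "tail T e \<in> verts T" "head T e \<in> verts T" if "e \<in> arcs T" for e
    using D.wellformed *[OF that] by (simp_all add: arb_digraph_simps(1,3,4))
  show "finite (verts T)" "finite (arcs T)" by (simp_all add: arb_digraph_simps)
  show "tail T e \<noteq> head T e" if "e \<in> arcs T" for e
    using D.no_loops *[OF that] by (simp add: arb_digraph_simps(3,4))
  show "e1 = e2" if "e1 \<in> arcs T" "e2 \<in> arcs T" "arc_to_ends T e1 = arc_to_ends T e2" for e1 e2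
    using D.no_multi_arcs *[OF that(1)] *[OF that(2)] that(3) by (simp add: arb_digraph_simps(5))
qed

lemma leaves_arb: "leaves T = arb_leaves (verts D) r p"
proof -
  interpret T: digraph T by (rule digraph_arb)
  have "out_degree T v = 0 \<longleftrightarrow> v \<notin> p ` (verts D - {r})" for v
  proof -
    have "out_degree T v = 0 \<longleftrightarrow> out_arcs T v = {}"
      unfolding out_degree_def using T.finite_out_arcs by (simp add: card_eq_0_iff)
    also have "\<dots> \<longleftrightarrow> v \<notin> p ` (verts D - {r})"
    proof
      assume *: "out_arcs T v = {}"
      show "v \<notin> p ` (verts D - {r})"
      proof
        assume "v \<in> p ` (verts D - {r})"
        then obtain w where w: "w \<in> verts D" "w \<noteq> r" "v = p w" by auto
        obtain e where "e \<in> arcs T" "head D e = w" "tail D e = p w" using parent_arc[OF w(1,2)] .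
        then have "e \<in> out_arcs T v" using w by (simp add: out_arcs_def arb_digraph_simps)
        with * show False by simp
      qed
    next
      assume *: "v \<notin> p ` (verts D - {r})"
      have False if e: "e \<in> out_arcs T v" for e
      proof -
        have "head D e \<in> verts D - {r}" "v = p (head D e)"
          using e by (auto simp: out_arcs_def arb_digraph_simps)
        then show False using * by blast
      qed
      then show "out_arcs T v = {}" by blast
    qed
    finally show ?thesis .
  qed
  then show ?thesis by (auto simp: leaves_def arb_leaves_def arb_digraph_simps)
qed

text \<open>The rank serves three times: it excludes 2-cycles, carries the induction by which
  \<open>r\<close> reaches every vertex, and excludes longer cycles in the underlying graph.\<close>

lemma out_branching_arb: "out_branching T D"
proof -
  interpret T: digraph T by (rule digraph_arb)
  interpret S: pair_wf_digraph "mk_symmetric T" by (rule T.wellformed_mk_symmetric)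
  obtain h :: "'a \<Rightarrow> nat" where "r \<in> verts D" "p r = r"
    "\<And>v. v \<in> verts D \<Longrightarrow> v \<noteq> r \<Longrightarrow> p v \<in> verts D"
    "\<And>v. v \<in> verts D \<Longrightarrow> v \<noteq> r \<Longrightarrow> (p v, v) \<in> arcs_ends D"
    and h: "\<And>v. v \<in> verts D \<Longrightarrow> v \<noteq> r \<Longrightarrow> h (p v) < h v"
    using arb by (rule out_arbE) blast
  have arcT: "tail T e = p (head T e) \<and> h (tail T e) < h (head T e)" if "e \<in> arcs T" for e
    using that h[of "head D e"] by (simp add: arb_digraph_simps)
  have rT: "r \<in> verts T" using arb by (auto simp: arb_digraph_simps(1) elim: out_arbE)
  have "spanning T D"
    using T.wf_digraph D.wf_digraph
    by (auto simp: spanning_def subgraph_def compatible_def arb_digraph_simps)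
  moreover have "oriented_graph T"
  proof
    fix u v assume uv: "u \<rightarrow>\<^bsub>T\<^esub> v"
    show "\<not> v \<rightarrow>\<^bsub>T\<^esub> u"
    proof
      assume "v \<rightarrow>\<^bsub>T\<^esub> u"
      with uv have "h u < h v" "h v < h u" using arcT by auto
      then show False by simp
    qed
  qed
  moreover have "Digraph_Component.connected T"
  proof -
    have reach: "r \<rightarrow>\<^sup>*\<^bsub>T\<^esub> v" if "v \<in> verts T" for v
      using that
    proof (induction "h v" arbitrary: v rule: less_induct)
      case less
      show ?case
      proof (cases "v = r")
        case True
        then show ?thesis using rT by simp
      next
        case False
        then obtain e where e: "e \<in> arcs T" "head D e = v" "tail D e = p v"
          using parent_arc less.prems by (auto simp: arb_digraph_simps(1))
        then have "arc_to_ends T e = (p v, v)" by (simp add: arc_to_ends_def arb_digraph_simps(3,4))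
        then have "p v \<rightarrow>\<^bsub>T\<^esub> v" using e(1) by (rule T.dominatesI)
        moreover have "h (p v) < h v" "p v \<in> verts T"
          using e arcT[OF e(1)] T.tail_in_verts[OF e(1)] by (auto simp: arb_digraph_simps(3,4))
        ultimately show ?thesis using less.hyps T.reachable_adj_trans by blast
      qed
    qed
    have sreach: "r \<rightarrow>\<^sup>*\<^bsub>mk_symmetric T\<^esub> v" if "v \<in> verts T" for v
      using T.reachable_mk_symmetricI[OF reach[OF that]] .
    show ?thesis unfolding connected_def
    proof
      show "verts (mk_symmetric T) \<noteq> {}" using rT by auto
      fix u v assume "u \<in> verts (mk_symmetric T)" "v \<in> verts (mk_symmetric T)"
      then have r: "r \<rightarrow>\<^sup>*\<^bsub>mk_symmetric T\<^esub> u" "r \<rightarrow>\<^sup>*\<^bsub>mk_symmetric T\<^esub> v" using sreach by auto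
      show "u \<rightarrow>\<^sup>*\<^bsub>mk_symmetric T\<^esub> v"
        by (rule S.reachable_trans[OF symmetric_reachable[OF symmetric_mk_symmetric r(1)] r(2)])
    qed
  qed
  moreover have "\<not> (\<exists>c. pre_digraph.cycle (with_proj (mk_symmetric T)) c \<and> 3 \<le> length c)"
    using parent_graph_cycle_length[of T p h, OF arcT] by (auto simp: not_le[symmetric])
  moreover have "\<exists>!r. r \<in> verts T \<and> in_degree T r = 0"
  proof
    show "r \<in> verts T \<and> in_degree T r = 0"
      using rT by (auto simp: in_degree_def in_arcs_def arb_digraph_simps)
    fix v assume v: "v \<in> verts T \<and> in_degree T v = 0"
    show "v = r"
    proof (rule ccontr)
      assume "v \<noteq> r"
      then obtain e where "e \<in> arcs T" "head D e = v"
        using parent_arc v by (auto simp: arb_digraph_simps(1))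
      then have "e \<in> in_arcs T v" by (simp add: in_arcs_def arb_digraph_simps)
      then show False using v T.finite_in_arcs[of v] by (auto simp: in_degree_def)
    qed
  qed
  ultimately show ?thesis
    by (simp add: out_branching_def out_tree_def oriented_tree_def underlying_tree_def)
qed

lemma card_arb_leaves_le_max_leaves: "card (arb_leaves (verts D) r p) \<le> max_leaves D"
proof -
  let ?A = "{card (leaves T) |T. out_branching T D}"
  \<comment> \<open>\<open>Max\<close> is informative only for a finite set; leaf numbers are at
    most the number of vertices.\<close>
  have "?A \<subseteq> {..card (verts D)}"
  proof
    fix x assume "x \<in> ?A"
    then obtain T where T: "x = card (leaves T)" "out_branching T D" by auto
    then have "leaves T \<subseteq> verts D" by (auto simp: leaves_def out_branching_def spanning_def)
    then show "x \<in> {..card (verts D)}" using T by (simp add: card_mono)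
  qed
  then have "finite ?A" using finite_subset by blast
  moreover have "card (arb_leaves (verts D) r p) \<in> ?A"
    by (intro CollectI exI[of _ "arb_digraph D r p"]) (simp add: out_branching_arb leaves_arb)
  ultimately have "card (arb_leaves (verts D) r p) \<le> Max ?A" by (rule Max_ge)
  then show ?thesis using out_branching_arb unfolding max_leaves_def by auto
qed

end

section \<open>The cube root, the degree conditions and the conclusion\<close>

lemma real_powr_third_le:
  assumes "n \<le> 4 * (m + 1) ^ 3"
  shows "(real n / 4) powr (1/3) - 1 \<le> real m"
proof -
  have "real n \<le> 4 * real (m + 1) ^ 3"
    using of_nat_mono[OF assms, where 'a = real] by simp
  then have "(real n / 4) powr (1/3) \<le> (real (m + 1) ^ 3) powr (1/3)"
    by (intro powr_mono2) auto
  also have "\<dots> = (real (m + 1) powr 3) powr (1/3)"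
    by (subst powr_numeral) auto
  also have "\<dots> = real (m + 1)"
    unfolding powr_powr by simp
  finally show ?thesis by simp
qed

lemma card_verts_le_max_leaves:
  fixes D :: "('a, 'b) pre_digraph"
  assumes D: "digraph D" and sc: "strongly_connected D"
    and extra: "\<And>u v w. v \<rightarrow>\<^bsub>D\<^esub> w \<Longrightarrow> \<exists>x. x \<rightarrow>\<^bsub>D\<^esub> v \<and> x \<noteq> w \<and> x \<noteq> u"
  shows "card (verts D) \<le> 4 * (max_leaves D + 1) ^ 3"
proof -
  interpret D: digraph D by (rule D)
  interpret R: strong_rel "verts D" "arcs_ends D"
  proof
    show "arcs_ends D \<subseteq> verts D \<times> verts D" using D.adj_in_verts by auto
    show "(v, v) \<notin> arcs_ends D" for v using D.adj_not_same by blast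
    show "(u, v) \<in> (arcs_ends D)\<^sup>*" if "u \<in> verts D" "v \<in> verts D" for u v
    proof -
      have "u \<rightarrow>\<^sup>*\<^bsub>D\<^esub> v" using sc that by (simp add: strongly_connected_def)
      then show ?thesis by (rule reachable_rtranclI)
    qed
  qed simp
  let ?arb = "\<lambda>(r, p). out_arb (arcs_ends D) (verts D) r p"
  let ?f = "\<lambda>(r, p). card (arb_leaves (verts D) r p)"
  obtain r0 where r0: "r0 \<in> verts D" using sc by (auto simp: strongly_connected_def)
  \<comment> \<open>The one-vertex tree extends to a spanning one, so there is something to
    maximise. Roots and parent functions vary together, as \<open>maximal\<close> demands.\<close>
  have "out_arb (arcs_ends D) {r0} r0 (\<lambda>_. r0)" by (rule out_arbI) auto
  then obtain q where "?arb (r0, q)" using R.out_arb_extend[of "{r0}" r0] r0 by auto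
  moreover have "\<forall>rp. ?arb rp \<longrightarrow> ?f rp < Suc (card (verts D))"
    by (auto simp: arb_leaves_def less_Suc_eq_le intro: card_mono)
  ultimately obtain rp where rp: "?arb rp" "\<And>sq. ?arb sq \<Longrightarrow> ?f sq \<le> ?f rp"
    using ex_has_greatest_nat[of ?arb "(r0, q)" ?f "Suc (card (verts D))"] by (auto simp: less_imp_le)
  obtain r p where "rp = (r, p)" by (cases rp)
  with rp have arb: "out_arb (arcs_ends D) (verts D) r p"
    and max: "\<And>s q. out_arb (arcs_ends D) (verts D) s q \<Longrightarrow>
      card (arb_leaves (verts D) s q) \<le> card (arb_leaves (verts D) r p)" by auto
  interpret max_arb "verts D" "arcs_ends D" r p
    by unfold_locales (use arb max extra in auto)
  have "card (verts D) \<le> 4 * (card (arb_leaves (verts D) r p) + 1) ^ 3" by (rule card_le_cube)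
  also have "\<dots> \<le> 4 * (max_leaves D + 1) ^ 3"
    using card_arb_leaves_le_max_leaves[OF D arb] by (intro mult_le_mono2 power_mono) auto
  finally show ?thesis .
qed

text \<open>\<open>in_degree\<close> counts arcs; without parallel arcs, distinct arcs into
  \<open>v\<close> have distinct tails.\<close>

lemma (in digraph) card_in_neighbours: "card {x. x \<rightarrow>\<^bsub>G\<^esub> v} = in_degree G v"
proof -
  have "{x. x \<rightarrow>\<^bsub>G\<^esub> v} = tail G ` in_arcs G v" by (auto simp: in_arcs_def arcs_ends_conv)
  moreover have "inj_on (tail G) (in_arcs G v)"
    by (auto simp: inj_on_def in_arcs_def arc_to_ends_def intro: no_multi_arcs)
  ultimately show ?thesis by (simp add: in_degree_def card_image)
qed

lemma (in digraph) exists_in_neighbour_avoiding: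
  assumes "v \<in> verts G" "finite A" "card A < min_in_degree G"
  shows "\<exists>x. x \<rightarrow>\<^bsub>G\<^esub> v \<and> x \<notin> A"
proof (rule ccontr)
  assume "\<not> ?thesis"
  then have "{x. x \<rightarrow>\<^bsub>G\<^esub> v} \<subseteq> A" by auto
  then have "in_degree G v \<le> card A"
    using card_mono[OF assms(2), of "{x. x \<rightarrow>\<^bsub>G\<^esub> v}"] card_in_neighbours[of v] by simp
  moreover have "min_in_degree G \<le> in_degree G v"
    using assms(1) by (simp add: min_in_degree_def)
  ultimately show False using assms(3) by simp
qed

theorem theorem4:
  fixes D :: "('a, 'b) pre_digraph" and n :: nat
  assumes "digraph D"
    and "strongly_connected D"
    and "card (verts D) = n"
  shows "(oriented_graph D \<and> 2 \<le> min_in_degree D \<longrightarrow>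
            (real n / 4) powr (1/3) - 1 \<le> real (max_leaves D)) \<and>
         (3 \<le> min_in_degree D \<longrightarrow>
            (real n / 4) powr (1/3) - 1 \<le> real (max_leaves D))"
proof -
  interpret D: digraph D by (rule assms(1))
  have bound: "(real n / 4) powr (1/3) - 1 \<le> real (max_leaves D)"
    if "\<And>u v w. v \<rightarrow>\<^bsub>D\<^esub> w \<Longrightarrow> \<exists>x. x \<rightarrow>\<^bsub>D\<^esub> v \<and> x \<noteq> w \<and> x \<noteq> u"
    using card_verts_le_max_leaves[OF assms(1,2) that] assms(3) by (intro real_powr_third_le) simp
  show ?thesis
  proof (intro conjI impI; (elim conjE)?)
    assume or: "oriented_graph D" and deg: "2 \<le> min_in_degree D"
    show "(real n / 4) powr (1/3) - 1 \<le> real (max_leaves D)"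
    proof (rule bound)
      \<comment> \<open>Without 2-cycles no in-neighbour of \<open>v\<close> equals the
        out-neighbour \<open>w\<close>. Only \<open>u\<close> must be avoided, so in-degree 2
        suffices.\<close>
      fix u v w assume vw: "v \<rightarrow>\<^bsub>D\<^esub> w"
      then obtain x where "x \<rightarrow>\<^bsub>D\<^esub> v" "x \<notin> {u}"
        using D.exists_in_neighbour_avoiding[of v "{u}"] deg D.adj_in_verts by auto
      moreover have "\<not> w \<rightarrow>\<^bsub>D\<^esub> v" using oriented_graph.no_2_cycles[OF or vw] .
      ultimately show "\<exists>x. x \<rightarrow>\<^bsub>D\<^esub> v \<and> x \<noteq> w \<and> x \<noteq> u" by blast
    qed
  next
    assume deg: "3 \<le> min_in_degree D"
    show "(real n / 4) powr (1/3) - 1 \<le> real (max_leaves D)"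
    proof (rule bound)
      fix u v w assume vw: "v \<rightarrow>\<^bsub>D\<^esub> w"
      \<comment> \<open>Here \<open>w\<close> may be an in-neighbour of \<open>v\<close> as well, so
        two vertices must be avoided.\<close>
      have "card {w, u} \<le> 2" by (simp add: card_insert_if)
      then show "\<exists>x. x \<rightarrow>\<^bsub>D\<^esub> v \<and> x \<noteq> w \<and> x \<noteq> u"
        using D.exists_in_neighbour_avoiding[of v "{w, u}"] deg D.adj_in_verts(1)[OF vw] by auto
    qed
  qed
qed

end
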